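(* For any $k\ge2$, $0\le a\le k-1$ and $1\le r\le k-1$, the lower-triangular array $F^{k,a,r}$ whose $(n,m)$-entry is $F^{k,a,r}_{n,m}$ ($0\le m\le n$) is a proper Riordan array with $A$-sequence and $Z$-sequence $$A(t)=(1+t)^k,\qquad Z(t)=\frac{(1+t)^k-(1+t)^{k-a-1}}{t}-(1+t)^{k-r-1}.$$
   Context: For $k\ge2$, $a\ge0$ and $1\le r\le k-1$, a generalized $(k,r)$-Fine path of depth $a$, semilength $n$ and semiheight $m$ is an integer lattice path from $(0,0)$ to $(kn,km)$ using steps $U=(1,1)$ and $D_{k-1}=(1,1-k)$ that stays weakly above the line $y=-a$ and contains no subpath of the form $U^rD_{k-1}$ ($r$ consecutive $U$ steps followed by a $D_{k-1}$ step) ending at height $0$. $F^{k,a,r}_{n,m}$ is the number of such paths. A proper Riordan array $\mathcal R(d(t),h(t))$, for formal power series with $d(0)\ne0$, $h(0)=0$, $h'(0)\neq 0$, is the lower-triangular array with $(i,j)$-entry $d_{i,j}=[t^i]\,d(t)h(t)^j$. Power series $A(t)=\sum a_rt^r$ and $Z(t)=\sum z_rt^r$ are its $A$-sequence and $Z$-sequence if for all $i\ge1$: $d_{i,j}=\sum_{s\ge0}a_s d_{i-1,j-1+s}$ for $j\ge1$ and $d_{i,0}=\sum_{s\ge0} z_s d_{i-1,s}$. *)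

theory Defs
  imports
    "HOL-Library.Product_Plus"
    "HOL-Library.Groups_Big_Fun"
    "HOL-Computational_Algebra.Formal_Power_Series"
begin

text \<open>A lattice path starting at the origin is the list of its steps, each step being a vector
  in the plane; the vertex reached after a prefix \<open>v\<close> of the steps is \<open>sum_list v\<close>.\<close>

definition up_step :: "int \<times> int" where
  "up_step = (1, 1)"

definition down_step :: "nat \<Rightarrow> int \<times> int" where
  "down_step k = (1, 1 - int k)"

definition stays_weakly_above :: "int \<Rightarrow> (int \<times> int) list \<Rightarrow> bool" where
  "stays_weakly_above b w \<longleftrightarrow> (\<forall>i\<le>length w. b \<le> snd (sum_list (take i w)))"

definition has_grounded_occurrence :: "(int \<times> int) list \<Rightarrow> (int \<times> int) list \<Rightarrow> bool" where
  "has_grounded_occurrence v w \<longleftrightarrow> (\<exists>p q. w = p @ v @ q \<and> snd (sum_list (p @ v)) = 0)"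

definition fine_paths :: "nat \<Rightarrow> nat \<Rightarrow> nat \<Rightarrow> nat \<Rightarrow> nat \<Rightarrow> (int \<times> int) list set" where
  "fine_paths k a r n m =
    {w. set w \<subseteq> {up_step, down_step k}
      \<and> sum_list w = (int (k * n), int (k * m))
      \<and> stays_weakly_above (- int a) w
      \<and> \<not> has_grounded_occurrence (replicate r up_step @ [down_step k]) w}"

definition fine_number :: "nat \<Rightarrow> nat \<Rightarrow> nat \<Rightarrow> nat \<Rightarrow> nat \<Rightarrow> nat" where
  "fine_number k a r n m = card (fine_paths k a r n m)"

definition fine_array :: "nat \<Rightarrow> nat \<Rightarrow> nat \<Rightarrow> nat \<Rightarrow> nat \<Rightarrow> 'a::field_char_0" where
  "fine_array k a r n m = (if m \<le> n then of_nat (fine_number k a r n m) else 0)"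

definition proper_riordan_array :: "(nat \<Rightarrow> nat \<Rightarrow> 'a::field_char_0) \<Rightarrow> bool" where
  "proper_riordan_array T \<longleftrightarrow>
    (\<exists>d h :: 'a fps. fps_nth d 0 \<noteq> 0 \<and> fps_nth h 0 = 0 \<and> fps_nth (fps_deriv h) 0 \<noteq> 0
      \<and> (\<forall>i j. T i j = fps_nth (d * h ^ j) i))"

text \<open>The sums over all \<open>s \<ge> 0\<close> below are finitely supported whenever \<open>T\<close> is lower triangular,
  in particular for every Riordan array; \<^const>\<open>Sum_any\<close> is then their actual value.\<close>

definition is_A_sequence :: "(nat \<Rightarrow> nat \<Rightarrow> 'a::field_char_0) \<Rightarrow> 'a fps \<Rightarrow> bool" where
  "is_A_sequence T A \<longleftrightarrow>
    (\<forall>i\<ge>1. \<forall>j\<ge>1. T i j = Sum_any (\<lambda>s. fps_nth A s * T (i - 1) (j - 1 + s)))"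

definition is_Z_sequence :: "(nat \<Rightarrow> nat \<Rightarrow> 'a::field_char_0) \<Rightarrow> 'a fps \<Rightarrow> bool" where
  "is_Z_sequence T Z \<longleftrightarrow>
    (\<forall>i\<ge>1. T i 0 = Sum_any (\<lambda>s. fps_nth Z s * T (i - 1) s))"

end

theory Submission
  imports Defs
begin

text \<open>Cut a path to \<open>(k(n+1), km)\<close> after its first \<open>kn\<close> steps. A height is congruent modulo \<open>k\<close>
  to the abscissa, so as \<open>a < k\<close> the first piece ends at a height \<open>ks\<close> with \<open>s \<ge> 0\<close>, and a forbidden
  pattern, which has at most \<open>k\<close> steps and ends at a multiple of \<open>k\<close>, lies inside the first piece or
  is a suffix of the last block. Hence the first piece is a Fine path and the block is a word with
  \<open>s + 1 - m\<close> down steps, arbitrary if \<open>m > 0\<close>. If \<open>m = 0\<close>, the path drops below \<open>-a\<close> inside the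
  block exactly when the block ends with \<open>a + 1\<close> up steps, so this suffix and the pattern itself are
  excluded. Counting the blocks gives the coefficients of \<open>A\<close> and \<open>Z\<close>, and \<open>h = t A(h)\<close>,
  \<open>d = d(0) / (1 - t Z(h))\<close> solve the recurrences.\<close>

section \<open>Riordan arrays from their A- and Z-sequences\<close>

text \<open>Since \<open>g\<close> has no constant term, \<open>g ^ s\<close> starts at order
  \<open>s\<close>, so powers beyond \<open>n\<close> are invisible in degree \<open>n\<close>. The
  common bound \<open>n\<close> for all inner coefficients allows the two sums to be swapped. This
  rewrites a row recurrence as a coefficient of a product with a composed series.\<close>

lemma fps_mult_compose_nth:
  fixes c f g :: "'a::comm_ring_1 fps"
  assumes "fps_nth g 0 = 0"
  shows "fps_nth (c * (f oo g)) n = (\<Sum>s\<le>n. fps_nth f s * fps_nth (c * g ^ s) n)"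
proof -
  have "fps_nth (f oo g) (n - i) = (\<Sum>s\<le>n. fps_nth f s * fps_nth (g ^ s) (n - i))" for i
    unfolding fps_compose_nth
    by (rule sum.mono_neutral_left) (auto simp: startsby_zero_power_prefix[OF assms])
  then have "fps_nth (c * (f oo g)) n
      = (\<Sum>i=0..n. \<Sum>s\<le>n. fps_nth f s * (fps_nth c i * fps_nth (g ^ s) (n - i)))"
    by (simp add: fps_mult_nth sum_distrib_left mult_ac)
  also have "\<dots> = (\<Sum>s\<le>n. fps_nth f s * fps_nth (c * g ^ s) n)"
    by (subst sum.swap) (simp add: fps_mult_nth sum_distrib_left)
  finally show ?thesis .
qed

text \<open>The bound \<open>s \<le> i\<close> is generous but independent of \<open>j\<close>,
  which matches the truncation in \<open>fps_mult_compose_nth\<close>.\<close>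

lemma Sum_any_lower_triangular:
  fixes T :: "nat \<Rightarrow> nat \<Rightarrow> 'a::field_char_0"
  assumes "\<And>i j. i < j \<Longrightarrow> T i j = 0"
  shows "Sum_any (\<lambda>s. f s * T i (j + s)) = (\<Sum>s\<le>i. f s * T i (j + s))"
  using assms[of i]
  by (intro Sum_any.expand_superset) (auto, metis linorder_not_le trans_less_add2)

text \<open>The solution is the compositional inverse of \<open>X / A(X)\<close>, which exists
  because this series has linear coefficient \<open>1 / A(0)\<close>.\<close>

lemma exists_fps_fixpoint:
  fixes A :: "'a::field_char_0 fps"
  assumes "fps_nth A 0 \<noteq> 0"
  obtains h where "fps_nth h 0 = 0" "h = fps_X * (A oo h)"
proof -
  define g where "g = fps_X * inverse A"
  define h where "h = fps_inv g"
  have h0: "fps_nth h 0 = 0" by (simp add: h_def fps_inv_def)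
  have "g oo h = fps_X"
    unfolding h_def using assms by (intro fps_inv_right) (auto simp: g_def)
  moreover have "g oo h = h * inverse (A oo h)"
    using h0 assms by (simp add: g_def fps_compose_mult_distrib fps_inverse_compose)
  ultimately have "fps_X * (A oo h) = h * (inverse (A oo h) * (A oo h))"
    by (simp add: mult_ac)
  also have "\<dots> = h" using assms by (simp add: inverse_mult_eq_1)
  finally show thesis using that h0 by metis
qed

text \<open>The two recurrences determine each row from the previous one, so induction on rows
  reduces the claim to the same recurrences for the coefficients of \<open>d * h ^ j\<close>. The
  linear coefficient of \<open>h\<close> is \<open>A(0)\<close>, whence properness.\<close>

lemma proper_riordan_arrayI:
  fixes T :: "nat \<Rightarrow> nat \<Rightarrow> 'a::field_char_0"
  assumes lower: "\<And>i j. i < j \<Longrightarrow> T i j = 0"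
    and T0: "T 0 0 \<noteq> 0" and A0: "fps_nth A 0 \<noteq> 0"
    and A: "is_A_sequence T A" and Z: "is_Z_sequence T Z"
  shows "proper_riordan_array T"
proof -
  obtain h where h0: "fps_nth h 0 = 0" and h: "h = fps_X * (A oo h)"
    using exists_fps_fixpoint[OF A0] .
  define d where "d = fps_const (T 0 0) * inverse (1 - fps_X * (Z oo h))"
  have d0: "fps_nth d 0 = T 0 0" by (simp add: d_def)
  have "d * (1 - fps_X * (Z oo h)) = fps_const (T 0 0)"
    by (simp add: d_def mult.assoc inverse_mult_eq_1)
  \<comment> \<open>In this form the coefficient of degree \<open>Suc i\<close> is exactly the
    column 0 recurrence.\<close>
  then have d: "d = fps_const (T 0 0) + fps_X * (d * (Z oo h))"
    by (simp add: algebra_simps)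
  have "T i j = fps_nth (d * h ^ j) i" for i j
  proof (induction i arbitrary: j)
    case 0
    then show ?case using d0 h0 lower by (cases j) auto
  next
    case (Suc i)
    show ?case
    proof (cases j)
      case 0
      have "T (Suc i) 0 = (\<Sum>s\<le>i. fps_nth Z s * T i s)"
        using Z Sum_any_lower_triangular[of T "fps_nth Z" i 0] lower by (simp add: is_Z_sequence_def)
      also have "\<dots> = fps_nth (d * (Z oo h)) i"
        by (simp add: Suc.IH fps_mult_compose_nth[OF h0])
      also have "\<dots> = fps_nth d (Suc i)"
        by (subst (2) d) simp
      finally show ?thesis using 0 by simp
    next
      case (Suc j')
      have "T (Suc i) (Suc j') = (\<Sum>s\<le>i. fps_nth A s * T i (j' + s))"
        using A Sum_any_lower_triangular[of T "fps_nth A" i j'] lower by (simp add: is_A_sequence_def)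
      also have "\<dots> = fps_nth (d * h ^ j' * (A oo h)) i"
        unfolding fps_mult_compose_nth[OF h0] by (simp add: Suc.IH power_add mult.assoc)
      also have "\<dots> = fps_nth (fps_X * (d * h ^ j' * (A oo h))) (Suc i)"
        by simp
      also have "fps_X * (d * h ^ j' * (A oo h)) = d * h ^ j' * (fps_X * (A oo h))"
        by (simp add: mult_ac)
      also have "\<dots> = d * h ^ Suc j'"
        by (simp add: h[symmetric] mult_ac)
      finally show ?thesis using Suc by simp
    qed
  qed
  moreover have "fps_nth h 1 = fps_nth A 0"
    by (subst h) simp
  ultimately show ?thesis
    unfolding proper_riordan_array_def using d0 T0 h0 A0
    by (intro exI[of _ d] exI[of _ h]) auto
qed

section \<open>Words in two letters\<close>

definition two_letter_words :: "'a \<Rightarrow> 'a \<Rightarrow> nat \<Rightarrow> nat \<Rightarrow> 'a list set" where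
  "two_letter_words x y n d = {v. set v \<subseteq> {x, y} \<and> length v = n \<and> count_list v y = d}"

lemma finite_two_letter_words: "finite (two_letter_words x y n d)"
  by (rule finite_subset[OF _ finite_lists_length_eq[of "{x, y}" n]])
    (auto simp: two_letter_words_def)

text \<open>Splitting by the first letter gives Pascal's rule. The case \<open>d = 0\<close> stands
  apart because \<open>d - 1\<close> is truncated subtraction.\<close>

lemma two_letter_words_Suc:
  assumes "x \<noteq> y"
  shows "two_letter_words x y (Suc n) d = (#) x ` two_letter_words x y n d
    \<union> (if d = 0 then {} else (#) y ` two_letter_words x y n (d - 1))"
  using assms by (auto simp: two_letter_words_def length_Suc_conv split: if_splits)

lemma card_two_letter_words:
  assumes "x \<noteq> y"
  shows "card (two_letter_words x y n d) = n choose d"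
proof (induction n arbitrary: d)
  case 0
  have "two_letter_words x y 0 d = (if d = 0 then {[]} else {})"
    by (auto simp: two_letter_words_def)
  then show ?case by simp
next
  case (Suc n)
  show ?case
  proof (cases d)
    case 0
    then show ?thesis
      using Suc.IH assms by (simp add: two_letter_words_Suc card_image)
  next
    case (Suc e)
    let ?X = "(#) x ` two_letter_words x y n d" and ?Y = "(#) y ` two_letter_words x y n e"
    have "finite ?X" "finite ?Y" by (simp_all add: finite_two_letter_words)
    moreover have "?X \<inter> ?Y = {}" using assms by blast
    moreover have "two_letter_words x y (Suc n) d = ?X \<union> ?Y"
      using Suc by (simp add: two_letter_words_Suc[OF assms])
    ultimately have "card (two_letter_words x y (Suc n) d) = card ?X + card ?Y"
      by (simp only: card_Un_disjoint)
    then show ?thesis using Suc.IH Suc by (simp add: card_image)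
  qed
qed

text \<open>Deleting the fixed suffix \<open>v\<close> is a bijection onto the free words of length
  \<open>n\<close>. It serves to count the blocks with a forbidden ending.\<close>

lemma card_two_letter_words_suffix:
  assumes "x \<noteq> y" and "set v \<subseteq> {x, y}" and "length v + n = l"
  shows "card {w \<in> two_letter_words x y l (d + count_list v y). drop n w = v} = n choose d"
proof -
  have "{w \<in> two_letter_words x y l (d + count_list v y). drop n w = v}
      = (\<lambda>u. u @ v) ` two_letter_words x y n d" (is "?L = ?R")
  proof (intro equalityI subsetI)
    fix w assume w: "w \<in> ?L"
    then have eq: "w = take n w @ v" using append_take_drop_id[of n w] by simp
    have "count_list w y = count_list (take n w) y + count_list v y"
      by (subst eq) simp
    moreover have "set (take n w) \<subseteq> set w" by (rule set_take_subset)
    ultimately have "take n w \<in> two_letter_words x y n d"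
      using w assms by (auto simp: two_letter_words_def)
    then show "w \<in> ?R" using eq by blast
  next
    fix w assume "w \<in> ?R"
    then obtain u where "w = u @ v" "u \<in> two_letter_words x y n d" by blast
    then show "w \<in> ?L" using assms(2,3) by (auto simp: two_letter_words_def)
  qed
  then show ?thesis
    by (simp add: card_image inj_on_def card_two_letter_words[OF assms(1)])
qed

section \<open>Splitting off the last block of a path\<close>

lemma up_step_neq_down_step [simp]: "1 \<le> k \<Longrightarrow> up_step \<noteq> down_step k"
  by (simp add: up_step_def down_step_def)

text \<open>A down step is an up step lowered by \<open>k\<close>. Hence height and abscissa agree
  modulo \<open>k\<close>, and the down step count determines the height.\<close>

lemma sum_list_steps:
  assumes "1 \<le> k" and "set w \<subseteq> {up_step, down_step k}"
  shows "sum_list w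
    = (int (length w), int (length w) - int k * int (count_list w (down_step k)))"
  using assms(2)
proof (induction w)
  case (Cons x w)
  then show ?case
    using up_step_neq_down_step[OF assms(1)]
    by (auto simp: up_step_def down_step_def algebra_simps)
qed (simp add: zero_prod_def)

lemma snd_sum_list_take_steps:
  assumes "1 \<le> k" and "set w \<subseteq> {up_step, down_step k}" and "i \<le> length w"
  shows "snd (sum_list (take i w)) = int i - int k * int (count_list (take i w) (down_step k))"
proof -
  have "set (take i w) \<subseteq> {up_step, down_step k}"
    using assms(2) set_take_subset by (rule subset_trans[rotated])
  then show ?thesis using sum_list_steps[OF assms(1)] assms(3) by simp
qed

lemma mem_fine_paths_iff:
  assumes "1 \<le> k"
  shows "w \<in> fine_paths k a r n m \<longleftrightarrow>
    set w \<subseteq> {up_step, down_step k} \<and> length w = k * n \<and> count_list w (down_step k) + m = n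
    \<and> stays_weakly_above (- int a) w
    \<and> \<not> has_grounded_occurrence (replicate r up_step @ [down_step k]) w"
proof -
  have "sum_list w = (int (k * n), int (k * m)) \<longleftrightarrow>
      length w = k * n \<and> count_list w (down_step k) + m = n"
    if "set w \<subseteq> {up_step, down_step k}"
  proof -
    have "int (k * n) - int k * int c = int (k * m) \<longleftrightarrow> c + m = n" for c
    proof -
      have "int (k * n) - int k * int c = int (k * m) \<longleftrightarrow> int k * int (c + m) = int k * int n"
        by (simp only: of_nat_mult of_nat_add distrib_left) linarith
      also have "\<dots> \<longleftrightarrow> c + m = n"
        by (simp only: of_nat_mult[symmetric] of_nat_eq_iff) (use assms in simp)
      finally show ?thesis .
    qed
    then show ?thesis
      unfolding sum_list_steps[OF assms that] prod.inject of_nat_eq_iff by metis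
  qed
  then show ?thesis unfolding fine_paths_def mem_Collect_eq by blast
qed

lemma stays_weakly_above_append:
  "stays_weakly_above b (u @ v) \<longleftrightarrow> stays_weakly_above b u
    \<and> (\<forall>i\<le>length v. b \<le> snd (sum_list u) + snd (sum_list (take i v)))"
proof (intro iffI conjI allI impI)
  assume *: "stays_weakly_above b (u @ v)"
  show "stays_weakly_above b u"
    unfolding stays_weakly_above_def
  proof (intro allI impI)
    fix i assume "i \<le> length u"
    then show "b \<le> snd (sum_list (take i u))"
      using *[unfolded stays_weakly_above_def, rule_format, of i] by simp
  qed
  fix i assume "i \<le> length v"
  then show "b \<le> snd (sum_list u) + snd (sum_list (take i v))"
    using *[unfolded stays_weakly_above_def, rule_format, of "length u + i"] by simp
next
  assume *: "stays_weakly_above b u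
    \<and> (\<forall>i\<le>length v. b \<le> snd (sum_list u) + snd (sum_list (take i v)))"
  show "stays_weakly_above b (u @ v)"
    unfolding stays_weakly_above_def
  proof (intro allI impI)
    fix i assume "i \<le> length (u @ v)"
    then show "b \<le> snd (sum_list (take i (u @ v)))"
      using * by (cases "i \<le> length u") (auto simp: stays_weakly_above_def)
  qed
qed

text \<open>An occurrence ending at height 0 ends at an abscissa \<open>k * c\<close>, with
  \<open>c\<close> the number of down steps so far. So it ends either within \<open>u\<close> or at
  the very end of the path, never strictly inside \<open>v\<close>.\<close>

lemma has_grounded_occurrence_append_block:
  assumes "1 \<le> k" and w: "set (u @ v) \<subseteq> {up_step, down_step k}"
    and u: "length u = k * n" and v: "length v = k"
    and m: "count_list (u @ v) (down_step k) + m = Suc n" and l: "length l \<le> k"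
  shows "has_grounded_occurrence l (u @ v) \<longleftrightarrow>
    has_grounded_occurrence l u \<or> m = 0 \<and> drop (k - length l) v = l"
proof
  assume "has_grounded_occurrence l (u @ v)"
  then obtain p q where pq: "u @ v = p @ l @ q" and z: "snd (sum_list (p @ l)) = 0"
    by (auto simp: has_grounded_occurrence_def)
  have pl: "set (p @ l) \<subseteq> {up_step, down_step k}" using w unfolding pq by simp
  define c where "c = count_list (p @ l) (down_step k)"
  have "int (length (p @ l)) = int k * int c"
    using z unfolding sum_list_steps[OF assms(1) pl] c_def by simp
  then have len: "length (p @ l) = k * c" by (metis of_nat_eq_iff of_nat_mult)
  show "has_grounded_occurrence l u \<or> m = 0 \<and> drop (k - length l) v = l"
  proof (cases "c \<le> n")
    case True
    then have "k * c \<le> k * n" by simp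
    then have "take (k * n) ((p @ l) @ q) = (p @ l) @ take (k * n - k * c) q"
      by (simp only: take_append[of _ "p @ l"] take_all len)
    then have "u = p @ l @ take (k * n - k * c) q"
      using arg_cong[OF pq, of "take (k * n)"] u by simp
    then show ?thesis using z unfolding has_grounded_occurrence_def by blast
  next
    case False
    have "k * c \<le> length (u @ v)" unfolding pq using len by simp
    then have "k * c \<le> k * Suc n" using u v by simp
    then have "c \<le> Suc n" using assms(1) by (subst (asm) nat_mult_le_cancel1) auto
    then have c: "c = Suc n" using False by simp
    have "length (u @ v) = length (p @ l)" using u v len c by simp
    then have q: "q = []" unfolding pq by simp
    have "m = 0" using m unfolding pq q using c c_def by simp
    moreover have "drop (k - length l) v = l"
    proof -
      \<comment> \<open>As \<open>l\<close> has at most \<open>k\<close> steps, \<open>p\<close>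
        covers all of \<open>u\<close>, so the occurrence is a suffix of \<open>v\<close>.\<close>
      have "length p = k * n + (k - length l)" using len c l by simp
      then show ?thesis
        using arg_cong[OF pq[unfolded q], of "drop (k * n + (k - length l))"] u by simp
    qed
    ultimately show ?thesis by simp
  qed
next
  assume "has_grounded_occurrence l u \<or> m = 0 \<and> drop (k - length l) v = l"
  then show "has_grounded_occurrence l (u @ v)"
  proof
    assume "has_grounded_occurrence l u"
    then obtain p q where "u = p @ l @ q" "snd (sum_list (p @ l)) = 0"
      by (auto simp: has_grounded_occurrence_def)
    then show ?thesis
      unfolding has_grounded_occurrence_def by (intro exI[of _ p] exI[of _ "q @ v"]) simp
  next
    assume *: "m = 0 \<and> drop (k - length l) v = l"
    \<comment> \<open>With \<open>m = 0\<close> the whole path ends at height 0, so a suffix equal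
      to \<open>l\<close> is grounded.\<close>
    then have eq: "u @ v = (u @ take (k - length l) v) @ l"
      by (metis append.assoc append_take_drop_id)
    have "snd (sum_list (u @ v)) = int (length (u @ v)) - int k * int (count_list (u @ v) (down_step k))"
      by (simp only: sum_list_steps[OF assms(1) w] snd_conv)
    also have "count_list (u @ v) (down_step k) = Suc n" using m * by simp
    also have "int (length (u @ v)) - int k * int (Suc n) = 0" using u v by (simp add: algebra_simps)
    finally have "snd (sum_list ((u @ take (k - length l) v) @ l)) = 0" unfolding eq .
    then show ?thesis
      unfolding has_grounded_occurrence_def
      using eq by (intro exI[of _ "u @ take (k - length l) v"] exI[of _ "[]"] conjI)
        (simp_all only: append_Nil2)
  qed
qed

text \<open>The height after \<open>i\<close> steps of the block is
  \<open>k * s + i - k * c\<close>, with \<open>c\<close> down steps used. It is nonnegative if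
  \<open>c \<le> s\<close>; otherwise all \<open>s + 1\<close> down steps are spent,
  \<open>m = 0\<close>, and the height is \<open>i - k\<close>, which is below \<open>-a\<close>
  exactly for \<open>i < k - a\<close>.\<close>

lemma block_stays_weakly_above_iff:
  assumes "1 \<le> k" and "a \<le> k - 1" and v: "set v \<subseteq> {up_step, down_step k}" "length v = k"
    and m: "count_list v (down_step k) + m = Suc s"
  shows "(\<forall>i\<le>k. - int a \<le> int (k * s) + snd (sum_list (take i v))) \<longleftrightarrow>
    (m = 0 \<longrightarrow> drop (k - a - 1) v \<noteq> replicate (a + 1) up_step)" (is "?L \<longleftrightarrow> ?R")
proof -
  let ?D = "down_step k"
  have count: "count_list (take i v) ?D + count_list (drop i v) ?D = count_list v ?D" for i
    by (metis append_take_drop_id count_list_append)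
  have bad: "\<not> - int a \<le> int (k * s) + snd (sum_list (take i v)) \<longleftrightarrow>
      i < k - a \<and> m = 0 \<and> ?D \<notin> set (drop i v)" if i: "i \<le> k" for i
  proof -
    define c where "c = count_list (take i v) ?D"
    have h: "snd (sum_list (take i v)) = int i - int k * int c"
      unfolding c_def using snd_sum_list_take_steps[OF assms(1) v(1)] i v(2) by simp
    have c: "c + count_list (drop i v) ?D + m = Suc s" using count[of i] m c_def by simp
    show ?thesis
    proof (cases "c \<le> s")
      case True
      then have "int k * int c \<le> int k * int s" by (intro mult_left_mono) auto
      moreover have "m \<noteq> 0 \<or> ?D \<in> set (drop i v)"
        using c True count_list_0_iff[of "drop i v" ?D] by auto
      ultimately show ?thesis using h by auto
    next
      case False
      then have "c = Suc s" "m = 0" "count_list (drop i v) ?D = 0" using c by auto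
      then show ?thesis
        using h i assms(1,2) by (auto simp: count_list_0_iff algebra_simps of_nat_diff)
    qed
  qed
  have suffix: "?D \<notin> set (drop (k - a - 1) v) \<longleftrightarrow>
      drop (k - a - 1) v = replicate (a + 1) up_step"
  proof
    assume *: "?D \<notin> set (drop (k - a - 1) v)"
    have "set (drop (k - a - 1) v) \<subseteq> {up_step}" using * v(1) set_drop_subset[of "k - a - 1" v] by blast
    moreover have "length (drop (k - a - 1) v) = a + 1" using v assms(1,2) by simp
    ultimately show "drop (k - a - 1) v = replicate (a + 1) up_step"
      by (metis replicate_eqI singletonD subsetD)
  next
    assume *: "drop (k - a - 1) v = replicate (a + 1) up_step"
    show "?D \<notin> set (drop (k - a - 1) v)"
      unfolding * using up_step_neq_down_step[OF assms(1)] by auto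
  qed
  have "\<not> ?L \<longleftrightarrow> (\<exists>i\<le>k. i < k - a \<and> m = 0 \<and> ?D \<notin> set (drop i v))"
    using bad by blast
  \<comment> \<open>The suffixes shrink as \<open>i\<close> grows, so the largest admissible index
    \<open>k - a - 1\<close> gives the weakest condition.\<close>
  also have "\<dots> \<longleftrightarrow> m = 0 \<and> ?D \<notin> set (drop (k - a - 1) v)"
  proof
    assume "\<exists>i\<le>k. i < k - a \<and> m = 0 \<and> ?D \<notin> set (drop i v)"
    then obtain i where i: "i < k - a" "m = 0" "?D \<notin> set (drop i v)" by blast
    then have "set (drop (k - a - 1) v) \<subseteq> set (drop i v)"
      by (intro set_drop_subset_set_drop) simp
    then show "m = 0 \<and> ?D \<notin> set (drop (k - a - 1) v)" using i by blast
  next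
    assume *: "m = 0 \<and> ?D \<notin> set (drop (k - a - 1) v)"
    show "\<exists>i\<le>k. i < k - a \<and> m = 0 \<and> ?D \<notin> set (drop i v)"
      using * assms(1,2) by (intro exI[of _ "k - a - 1"]) auto
  qed
  finally show ?thesis using suffix by blast
qed

text \<open>The possible last \<open>k\<close> steps of a path that go from height \<open>ks\<close> to height \<open>km\<close>.\<close>

definition fine_blocks :: "nat \<Rightarrow> nat \<Rightarrow> nat \<Rightarrow> nat \<Rightarrow> nat \<Rightarrow> (int \<times> int) list set" where
  "fine_blocks k a r s m =
    {v. set v \<subseteq> {up_step, down_step k} \<and> length v = k \<and> count_list v (down_step k) + m = Suc s
      \<and> (m = 0 \<longrightarrow> drop (k - a - 1) v \<noteq> replicate (a + 1) up_step
                 \<and> drop (k - r - 1) v \<noteq> replicate r up_step @ [down_step k])}"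

text \<open>The blocks that may follow a Fine path \<open>u\<close> depend on \<open>u\<close> only
  through its final height \<open>k * s\<close>.\<close>

lemma append_mem_fine_paths_iff:
  assumes "1 \<le> k" and "a \<le> k - 1" and "r \<le> k - 1"
    and u: "u \<in> fine_paths k a r n s" and v: "set v \<subseteq> {up_step, down_step k}" "length v = k"
  shows "u @ v \<in> fine_paths k a r (Suc n) m \<longleftrightarrow> v \<in> fine_blocks k a r s m"
proof -
  let ?D = "down_step k" and ?l = "replicate r up_step @ [down_step k]"
  have u': "set u \<subseteq> {up_step, ?D}" "length u = k * n" "count_list u ?D + s = n"
    "stays_weakly_above (- int a) u" "\<not> has_grounded_occurrence ?l u"
    using u mem_fine_paths_iff[OF assms(1)] by auto
  have hu: "snd (sum_list u) = int (k * s)"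
    using u by (simp add: fine_paths_def)
  show ?thesis
  proof (cases "count_list v ?D + m = Suc s")
    case True
    have "has_grounded_occurrence ?l (u @ v) \<longleftrightarrow>
        has_grounded_occurrence ?l u \<or> m = 0 \<and> drop (k - length ?l) v = ?l"
      by (rule has_grounded_occurrence_append_block) (use u' v True assms in auto)
    then show ?thesis
      using u' v True hu block_stays_weakly_above_iff[OF assms(1,2) v True]
      by (auto simp: mem_fine_paths_iff[OF assms(1)] fine_blocks_def stays_weakly_above_append)
  \<comment> \<open>With the wrong number of down steps in \<open>v\<close>, both sides
    fail.\<close>
  next
    case False
    then show ?thesis
      using u' by (auto simp: mem_fine_paths_iff[OF assms(1)] fine_blocks_def)
  qed
qed

text \<open>The first piece ends at a multiple of \<open>k\<close> that is at least
  \<open>-a > -k\<close>, hence at a nonnegative one. This is where \<open>a \<le> k - 1\<close>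
  enters.\<close>

lemma take_mem_fine_paths:
  assumes "1 \<le> k" and "a \<le> k - 1" and w: "w \<in> fine_paths k a r (Suc n) m"
  obtains s where "s \<le> n" and "take (k * n) w \<in> fine_paths k a r n s"
proof -
  define u v where "u = take (k * n) w" and "v = drop (k * n) w"
  have uv: "w = u @ v" by (simp add: u_def v_def)
  have w': "set w \<subseteq> {up_step, down_step k}" "length w = k * Suc n"
    "stays_weakly_above (- int a) w"
    "\<not> has_grounded_occurrence (replicate r up_step @ [down_step k]) w"
    using w mem_fine_paths_iff[OF assms(1)] by auto
  have len: "length u = k * n" using w' by (simp add: u_def)
  have set: "set u \<subseteq> {up_step, down_step k}" using w'(1) unfolding uv by simp
  have stays: "stays_weakly_above (- int a) u"
    using w'(3) unfolding uv stays_weakly_above_append by blast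
  have gr: "\<not> has_grounded_occurrence (replicate r up_step @ [down_step k]) u"
    using w'(4) unfolding uv has_grounded_occurrence_def by fastforce
  have "- int a \<le> int (k * n) - int k * int (count_list u (down_step k))"
    using stays sum_list_steps[OF assms(1) set] len
    by (auto simp: stays_weakly_above_def dest!: spec[of _ "length u"])
  then have "int (k * count_list u (down_step k)) < int (k * Suc n)"
    using assms(1,2) by (simp add: algebra_simps)
  then have "count_list u (down_step k) < Suc n"
    by (metis of_nat_less_iff mult_less_cancel1)
  then show thesis
    using that[of "n - count_list u (down_step k)"] len set stays gr
    by (simp add: mem_fine_paths_iff[OF assms(1)] u_def)
qed

section \<open>The recurrence\<close>

lemma finite_fine_paths:
  assumes "1 \<le> k"
  shows "finite (fine_paths k a r n m)"
  by (rule finite_subset[OF _ finite_lists_length_eq[of "{up_step, down_step k}" "k * n"]])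
    (auto simp: mem_fine_paths_iff[OF assms])

lemma fine_number_eq_0:
  assumes "1 \<le> k" and "n < m"
  shows "fine_number k a r n m = 0"
proof -
  have "fine_paths k a r n m = {}" using assms by (auto simp: mem_fine_paths_iff)
  then show ?thesis by (simp add: fine_number_def)
qed

lemma fine_array_eq:
  assumes "1 \<le> k"
  shows "fine_array k a r n m = of_nat (fine_number k a r n m)"
  using fine_number_eq_0[OF assms] by (simp add: fine_array_def)

lemma finite_fine_blocks: "finite (fine_blocks k a r s m)"
  by (rule finite_subset[OF _ finite_lists_length_eq[of "{up_step, down_step k}" k]])
    (auto simp: fine_blocks_def)

text \<open>Concatenation is a bijection from the triples \<open>(s, u, v)\<close> to the longer
  paths: the cut lies at the fixed abscissa \<open>k * n\<close>, and \<open>u\<close> determines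
  \<open>s\<close>.\<close>

lemma fine_number_Suc:
  assumes "1 \<le> k" and "a \<le> k - 1" and "r \<le> k - 1"
  shows "fine_number k a r (Suc n) m
    = (\<Sum>s\<le>n. fine_number k a r n s * card (fine_blocks k a r s m))"
proof -
  let ?S = "SIGMA s:{..n}. fine_paths k a r n s \<times> fine_blocks k a r s m"
  let ?f = "\<lambda>(s, u, v). u @ v"
  have len: "length u = k * n" "count_list u (down_step k) + s = n"
    if "u \<in> fine_paths k a r n s" for u s
    using that by (auto simp: mem_fine_paths_iff[OF assms(1)])
  have "inj_on ?f ?S"
  proof (rule inj_onI, clarsimp)
    fix s u v s' u' v'
    assume u: "u \<in> fine_paths k a r n s" "u' \<in> fine_paths k a r n s'" and eq: "u @ v = u' @ v'"
    have "length u = length u'" using len u by simp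
    then have "u = u' \<and> v = v'" using eq by simp
    then show "s = s' \<and> u = u' \<and> v = v'" using len(2)[OF u(1)] len(2)[OF u(2)] by simp
  qed
  moreover have "?f ` ?S = fine_paths k a r (Suc n) m"
  proof (intro equalityI subsetI)
    fix w assume "w \<in> ?f ` ?S"
    then obtain s u v where "w = u @ v" "u \<in> fine_paths k a r n s" "v \<in> fine_blocks k a r s m"
      by (elim imageE SigmaE) simp
    then show "w \<in> fine_paths k a r (Suc n) m"
      using append_mem_fine_paths_iff[OF assms, of u n s v m] by (auto simp: fine_blocks_def)
  next
    fix w assume w: "w \<in> fine_paths k a r (Suc n) m"
    obtain s where s: "s \<le> n" "take (k * n) w \<in> fine_paths k a r n s"
      using take_mem_fine_paths[OF assms(1,2) w] .
    have v: "set (drop (k * n) w) \<subseteq> {up_step, down_step k}" "length (drop (k * n) w) = k"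
      using w set_drop_subset[of "k * n" w] by (auto simp: mem_fine_paths_iff[OF assms(1)])
    have "drop (k * n) w \<in> fine_blocks k a r s m"
      using append_mem_fine_paths_iff[OF assms s(2) v, of m] w by simp
    then show "w \<in> ?f ` ?S"
      using s by (intro image_eqI[of _ _ "(s, take (k * n) w, drop (k * n) w)"]) auto
  qed
  ultimately have "card (fine_paths k a r (Suc n) m) = card ?S"
    using card_image[of ?f ?S] by (simp only:)
  then show ?thesis
    by (simp add: fine_number_def card_cartesian_product finite_fine_blocks
        finite_fine_paths[OF assms(1)])
qed

text \<open>A block ending at positive height is an arbitrary word with \<open>s - j\<close> down
  steps.\<close>

lemma card_fine_blocks_Suc:
  assumes "1 \<le> k"
  shows "card (fine_blocks k a r s (Suc j)) = (if j \<le> s then k choose (s - j) else 0)"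
proof -
  have "fine_blocks k a r s (Suc j)
      = (if j \<le> s then two_letter_words up_step (down_step k) k (s - j) else {})"
    by (auto simp: fine_blocks_def two_letter_words_def)
  then show ?thesis using assms by (simp add: card_two_letter_words)
qed

text \<open>From all words with \<open>s + 1\<close> down steps, those ending in
  \<open>a + 1\<close> up steps and those ending in the pattern are removed. The additive form
  avoids truncated subtraction.\<close>

lemma card_fine_blocks_0:
  assumes "1 \<le> k" and "a \<le> k - 1" and "r \<le> k - 1"
  shows "card (fine_blocks k a r s 0) + ((k - a - 1) choose Suc s) + ((k - r - 1) choose s)
    = k choose Suc s"
proof -
  let ?U = up_step and ?D = "down_step k"
  have UD: "?U \<noteq> ?D" using assms(1) by simp
  let ?W = "two_letter_words ?U ?D k (Suc s)"
  let ?P = "{v \<in> ?W. drop (k - a - 1) v = replicate (a + 1) ?U}"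
  let ?Q = "{v \<in> ?W. drop (k - r - 1) v = replicate r ?U @ [?D]}"
  have fin: "finite ?W" by (rule finite_two_letter_words)
  have count: "count_list (replicate i ?U) ?D = 0" for i
    using UD by (auto simp: count_list_0_iff)
  have P: "card ?P = (k - a - 1) choose Suc s"
    using card_two_letter_words_suffix[OF UD, of "replicate (a + 1) ?U" "k - a - 1" k "Suc s"]
      assms(1,2) count[of "a + 1"] by (auto simp del: replicate_Suc replicate.simps)
  \<comment> \<open>The pattern uses one down step, which leaves \<open>s\<close> for the free part;
    the all-up suffix leaves \<open>Suc s\<close>.\<close>
  have Q: "card ?Q = (k - r - 1) choose s"
    using card_two_letter_words_suffix[OF UD, of "replicate r ?U @ [?D]" "k - r - 1" k s]
      assms(1,3) count[of r] by (simp add: set_replicate_conv_if)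
  \<comment> \<open>The two forbidden endings exclude each other since their last letters
    differ.\<close>
  have "last v = ?U" if "v \<in> ?P" for v
  proof -
    have "last (drop (k - a - 1) v) = last v"
      using that assms(1,2) by (intro last_drop) (auto simp: two_letter_words_def)
    then show ?thesis using that by (simp split: if_splits)
  qed
  moreover have "last v = ?D" if "v \<in> ?Q" for v
  proof -
    have "last (drop (k - r - 1) v) = last v"
      using that assms(1,3) by (intro last_drop) (auto simp: two_letter_words_def)
    then show ?thesis using that by simp
  qed
  ultimately have disj: "?P \<inter> ?Q = {}" using UD by (metis (no_types, lifting) disjoint_iff)
  have W: "?W = fine_blocks k a r s 0 \<union> (?P \<union> ?Q)"
    by (auto simp: fine_blocks_def two_letter_words_def)
  have disj': "fine_blocks k a r s 0 \<inter> (?P \<union> ?Q) = {}"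
    by (auto simp: fine_blocks_def)
  have PQ: "finite ?P" "finite ?Q" using fin by simp_all
  have "card ?W = card (fine_blocks k a r s 0) + card (?P \<union> ?Q)"
    by (rule trans[OF arg_cong[OF W, of card]
          card_Un_disjoint[OF finite_fine_blocks finite_UnI[OF PQ] disj']])
  also have "card (?P \<union> ?Q) = card ?P + card ?Q"
    by (rule card_Un_disjoint[OF PQ disj])
  finally show ?thesis by (simp only: P Q card_two_letter_words[OF UD])
qed

section \<open>Reading the block counts as coefficients of A and Z\<close>

lemma one_plus_fps_X_power_nth:
  "fps_nth ((1 + fps_X) ^ n :: 'a::field_char_0 fps) i = of_nat (n choose i)"
  by (simp add: fps_binomial_of_nat[symmetric] binomial_gbinomial)

lemma fine_array_Suc_Suc:
  assumes "1 \<le> k" and "a \<le> k - 1" and "r \<le> k - 1"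
  shows "fine_array k a r (Suc n) (Suc m)
    = (\<Sum>s\<le>n. of_nat (k choose s) * fine_array k a r n (m + s) :: 'a::field_char_0)"
proof -
  let ?T = "fine_array k a r :: nat \<Rightarrow> nat \<Rightarrow> 'a"
  have "?T (Suc n) (Suc m) = (\<Sum>s\<le>n. if m \<le> s then of_nat (k choose (s - m)) * ?T n s else 0)"
    by (auto simp: fine_array_eq[OF assms(1)] fine_number_Suc[OF assms]
        card_fine_blocks_Suc[OF assms(1)] intro!: sum.cong)
  also have "\<dots> = (\<Sum>s\<in>{m..n}. of_nat (k choose (s - m)) * ?T n s)"
    by (rule sum.mono_neutral_cong_right) auto
  \<comment> \<open>The added entries lie above the diagonal and vanish; the longer range shifts
    exactly to \<open>s \<le> n\<close>.\<close>
  also have "\<dots> = (\<Sum>s\<in>{m..n + m}. of_nat (k choose (s - m)) * ?T n s)"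
    by (rule sum.mono_neutral_left) (auto simp: fine_array_def)
  also have "\<dots> = (\<Sum>s\<le>n. of_nat (k choose s) * ?T n (m + s))"
    using sum.shift_bounds_cl_nat_ivl[of "\<lambda>s. of_nat (k choose (s - m)) * ?T n s" 0 m n]
    by (simp add: atLeast0AtMost add.commute)
  finally show ?thesis .
qed

lemma fine_array_Suc_0:
  assumes "1 \<le> k" and "a \<le> k - 1" and "r \<le> k - 1"
  shows "fine_array k a r (Suc n) 0
    = (\<Sum>s\<le>n. (of_nat (k choose Suc s) - of_nat ((k - a - 1) choose Suc s)
        - of_nat ((k - r - 1) choose s)) * fine_array k a r n s :: 'a::field_char_0)"
proof -
  have "(of_nat (card (fine_blocks k a r s 0)) :: 'a)
      = of_nat (k choose Suc s) - of_nat ((k - a - 1) choose Suc s) - of_nat ((k - r - 1) choose s)" for s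
    unfolding card_fine_blocks_0[OF assms, of s, symmetric] of_nat_add by algebra
  then show ?thesis
    by (simp only: fine_array_eq[OF assms(1)] fine_number_Suc[OF assms] of_nat_sum of_nat_mult
        mult.commute)
qed

lemma is_A_sequence_fine_array:
  assumes "1 \<le> k" and "a \<le> k - 1" and "r \<le> k - 1"
  shows "is_A_sequence (fine_array k a r :: nat \<Rightarrow> nat \<Rightarrow> 'a::field_char_0) ((1 + fps_X) ^ k)"
proof -
  let ?T = "fine_array k a r :: nat \<Rightarrow> nat \<Rightarrow> 'a"
  have "?T (Suc n) (Suc m) = Sum_any (\<lambda>s. fps_nth ((1 + fps_X) ^ k) s * ?T n (m + s))" for n m
    unfolding fine_array_Suc_Suc[OF assms] one_plus_fps_X_power_nth
    by (rule Sum_any_lower_triangular[of ?T "\<lambda>s. of_nat (k choose s)" n m, symmetric])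
      (simp add: fine_array_def)
  then show ?thesis
    by (auto simp: is_A_sequence_def Suc_le_eq gr0_conv_Suc)
qed

lemma is_Z_sequence_fine_array:
  assumes "1 \<le> k" and "a \<le> k - 1" and "r \<le> k - 1"
  shows "is_Z_sequence (fine_array k a r :: nat \<Rightarrow> nat \<Rightarrow> 'a::field_char_0)
    (((1 + fps_X) ^ k - (1 + fps_X) ^ (k - a - 1)) / fps_X - (1 + fps_X) ^ (k - r - 1))"
    (is "is_Z_sequence _ ?Z")
proof -
  let ?T = "fine_array k a r :: nat \<Rightarrow> nat \<Rightarrow> 'a"
  \<comment> \<open>Both powers have constant term 1, so the division by \<open>fps_X\<close> is
    exact and lowers each index by one.\<close>
  have Z: "fps_nth ?Z s = of_nat (k choose Suc s) - of_nat ((k - a - 1) choose Suc s)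
      - of_nat ((k - r - 1) choose s)" for s
    by (simp add: one_plus_fps_X_power_nth)
  have "?T (Suc n) 0 = Sum_any (\<lambda>s. fps_nth ?Z s * ?T n s)" for n
    unfolding fine_array_Suc_0[OF assms] Z[symmetric]
    by (rule Sum_any_lower_triangular[of ?T "fps_nth ?Z" n 0, unfolded add_0, symmetric])
      (simp add: fine_array_def)
  then show ?thesis
    by (auto simp only: is_Z_sequence_def One_nat_def Suc_le_eq gr0_conv_Suc diff_Suc_1')
qed

lemma fine_number_0_0:
  assumes "1 \<le> k"
  shows "fine_number k a r 0 0 = 1"
proof -
  have "fine_paths k a r 0 0 = {[]}"
    using assms
    by (auto simp: mem_fine_paths_iff stays_weakly_above_def has_grounded_occurrence_def)
  then show ?thesis by (simp add: fine_number_def)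
qed

theorem theorem3p5:
  fixes k a r :: nat
  assumes "2 \<le> k" and "a \<le> k - 1" and "1 \<le> r" and "r \<le> k - 1"
  shows "proper_riordan_array (fine_array k a r :: nat \<Rightarrow> nat \<Rightarrow> 'a::field_char_0)
    \<and> is_A_sequence (fine_array k a r :: nat \<Rightarrow> nat \<Rightarrow> 'a) ((1 + fps_X) ^ k)
    \<and> is_Z_sequence (fine_array k a r :: nat \<Rightarrow> nat \<Rightarrow> 'a)
        (((1 + fps_X) ^ k - (1 + fps_X) ^ (k - a - 1)) / fps_X - (1 + fps_X) ^ (k - r - 1))"
proof -
  have k: "1 \<le> k" using assms(1) by simp
  note A = is_A_sequence_fine_array[OF k assms(2,4), where ?'a = 'a]
  note Z = is_Z_sequence_fine_array[OF k assms(2,4), where ?'a = 'a]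
  \<comment> \<open>Besides the recurrences this needs zeros above the diagonal, a nonzero corner
    entry (here 1) and a nonzero constant term of \<open>(1 + fps_X) ^ k\<close>.\<close>
  have "proper_riordan_array (fine_array k a r :: nat \<Rightarrow> nat \<Rightarrow> 'a)"
    using A Z
    by (rule proper_riordan_arrayI[rotated 3])
      (simp_all add: fine_array_def fine_number_0_0[OF k] one_plus_fps_X_power_nth)
  with A Z show ?thesis by blast
qed

end
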